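(* Let $X$ be a Banach space over $\mathbb{K}\in\{\mathbb{R},\mathbb{C}\}$ and let $A:\mathbb{K}\to\mathbb{L}_X$. The linear nonautonomous differential equation $$\dot{x}(t)=A(t)x(t)$$ on $X$ has an evolution operator associated to it if and only if $A$ is the infinitesimal generator of a differentiable cotranslation $Z:\mathbb{K}\times\mathbb{K}\to\mathbb{A}_X$.
   Context: $\mathbb{L}_X$ is the collection of all densely defined linear operators on $X$; $\mathbb{B}_X$ is the algebra of all continuous linear operators on $X$, given the strong (operator) topology; $\mathbb{A}_X$ is the group of invertible elements of $\mathbb{B}_X$ whose inverse is in $\mathbb{B}_X$. For $\varphi:\mathbb{K}\times\mathbb{K}\to\mathbb{B}_X$, write $\partial_1\varphi(r,t)=\lim_{h\to0}\frac{\varphi(r+h,t)-\varphi(r,t)}{h}$ and $\partial_2\varphi(r,t)=\lim_{h\to0}\frac{\varphi(r,t+h)-\varphi(r,t)}{h}$, limits being taken in the strong topology. A cotranslation $Z:\mathbb{K}\times\mathbb{K}\to\mathbb{A}_X$ (for the additive group $\mathbb{K}$) is a map with $Z(r,t+s)=Z(r+s,t)Z(r,s)$ for all $r,s,t\in\mathbb{K}$. A differentiable cotranslation is a continuous cotranslation such that for every $r\in\mathbb{K}$ the map $t\mapsto Z(r,t)$ is derivable at $t=0$ (equivalently, derivable at every $t$). Its infinitesimal generator is the function $A:\mathbb{K}\to\mathbb{L}_X$, $A(t)=\partial_2Z(t,0)$. A map $\Psi:\mathbb{K}\times\mathbb{K}\to\mathbb{B}_X$ is the evolution operator associated to $\dot{x}=A(t)x(t)$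 if: (i) $\Psi(r,r)=\mathrm{Id}$ and $\Psi(r,t)\Psi(t,s)=\Psi(r,s)$ for every $r,s,t\in\mathbb{K}$; (ii) $(r,t)\mapsto\Psi(r,t)\in\mathbb{B}_X$ is strongly continuous; (iii) $\partial_1\Psi(r,t)=A(r)\Psi(r,t)$ and $\partial_2\Psi(r,t)=-\Psi(r,t)A(t)$. (The paper glosses the existence of such $\Psi$ as: unique and globally defined solution for every initial condition on $X$.) *)

theory Defs
  imports "HOL-Analysis.Analysis"
begin

text \<open>
  The scalar field is the real or the complex numbers.  A multiplicative norm on the field
  \<open>\<complex>\<close> that extends the absolute value of \<open>\<real>\<close> is the usual modulus, so the second
  alternative below needs no separate condition on the norm.
\<close>

class real_or_complex = real_normed_field +
  assumes real_or_complex: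
    "(\<forall>x. \<exists>a. x = a *\<^sub>R 1) \<or>
     (\<exists>i. i * i = - 1 \<and> (\<forall>x. \<exists>a b. x = a *\<^sub>R 1 + b *\<^sub>R i))"

instance real :: real_or_complex
  by standard simp

instance complex :: real_or_complex
proof
  have "x = Re x *\<^sub>R 1 + Im x *\<^sub>R \<i>" for x
    by (simp add: complex_eq_iff)
  then show "(\<forall>x::complex. \<exists>a. x = a *\<^sub>R 1) \<or>
    (\<exists>i::complex. i * i = - 1 \<and> (\<forall>x. \<exists>a b. x = a *\<^sub>R 1 + b *\<^sub>R i))"
    by (intro disjI2 exI[of _ \<i>]) (simp, blast)
qed

text \<open>
  The type class \<^class>\<open>banach\<close> only provides real Banach spaces; the Banach space over \<open>'k\<close>
  has the same norm and a scalar multiplication that extends the real one.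
\<close>

locale banach_over = vector_space scale
  for scale :: "'k::real_or_complex \<Rightarrow> 'a::banach \<Rightarrow> 'a" (infixr \<open>*\<^sub>K\<close> 75) +
  assumes scale_of_real: "of_real a *\<^sub>K x = a *\<^sub>R x"
    and norm_scale: "norm (c *\<^sub>K x) = norm c * norm x"

lemma banach_over_scaleR: "banach_over (scaleR :: real \<Rightarrow> 'a::banach \<Rightarrow> 'a)"
  by unfold_locales (simp_all add: algebra_simps)

lemma banach_over_complex: "banach_over ((*) :: complex \<Rightarrow> complex \<Rightarrow> complex)"
  by unfold_locales (simp_all add: algebra_simps norm_mult scaleR_conv_of_real)

text \<open>
  Not necessarily everywhere defined operators are partial maps \<open>'a \<rightharpoonup> 'a\<close>, so that equality
  of operators includes equality of their domains.  The pointwise limit of a family of maps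
  is the operator whose domain consists of all points at which the limit exists.
\<close>

definition strong_lim :: "'h filter \<Rightarrow> ('h \<Rightarrow> 'a \<Rightarrow> 'a) \<Rightarrow> ('a::t2_space \<rightharpoonup> 'a)" where
  "strong_lim F D =
     (\<lambda>x. if \<exists>y. ((\<lambda>h. D h x) \<longlongrightarrow> y) F then Some (Lim F (\<lambda>h. D h x)) else None)"

lemma strong_lim_eq_Some_iff:
  assumes "F \<noteq> bot"
  shows "strong_lim F D x = Some y \<longleftrightarrow> ((\<lambda>h. D h x) \<longlongrightarrow> y) F"
  using assms tendsto_Lim[OF assms] by (auto simp: strong_lim_def)

lemma strong_lim_eq_blinfun_iff:
  fixes D :: "'h \<Rightarrow> 'a::real_normed_vector \<Rightarrow>\<^sub>L 'a"
  assumes "F \<noteq> bot"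
  shows "strong_lim F (\<lambda>h. blinfun_apply (D h)) = Some \<circ> blinfun_apply T \<longleftrightarrow>
    limitin strong_operator_topology D T F"
proof -
  have "limitin strong_operator_topology D T F \<longleftrightarrow>
      ((\<lambda>h. blinfun_apply (D h)) \<longlongrightarrow> blinfun_apply T) F"
    unfolding strong_operator_topology_def limitin_def tendsto_def
    by (auto simp: openin_pullback_topology topspace_pullback_topology)
  also have "\<dots> \<longleftrightarrow> (\<forall>x. ((\<lambda>h. D h x) \<longlongrightarrow> T x) F)"
    using limitin_componentwise[of "\<lambda>_. euclidean" UNIV "\<lambda>h. blinfun_apply (D h)" "blinfun_apply T" F]
    by (simp add: euclidean_product_topology)
  finally show ?thesis
    using assms by (simp add: fun_eq_iff strong_lim_eq_Some_iff)
qed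

context banach_over
begin

definition densely_defined_ops :: "('a \<rightharpoonup> 'a) set" where
  "densely_defined_ops = {T. subspace (dom T) \<and> closure (dom T) = UNIV \<and>
     (\<forall>x\<in>dom T. \<forall>y\<in>dom T. the (T (x + y)) = the (T x) + the (T y)) \<and>
     (\<forall>c. \<forall>x\<in>dom T. the (T (c *\<^sub>K x)) = c *\<^sub>K the (T x))}"

text \<open>The type \<open>'a \<Rightarrow>\<^sub>L 'a\<close> consists of the real linear continuous operators.\<close>

definition bounded_ops :: "('a \<Rightarrow>\<^sub>L 'a) set" where
  "bounded_ops = {T :: 'a \<Rightarrow>\<^sub>L 'a. \<forall>c x. T (c *\<^sub>K x) = c *\<^sub>K T x}"

definition invertible_ops :: "('a \<Rightarrow>\<^sub>L 'a) set" where
  "invertible_ops =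
     {T \<in> bounded_ops. \<exists>S\<in>bounded_ops. S o\<^sub>L T = id_blinfun \<and> T o\<^sub>L S = id_blinfun}"

definition partial1 :: "('k \<Rightarrow> 'k \<Rightarrow> 'a \<Rightarrow>\<^sub>L 'a) \<Rightarrow> 'k \<Rightarrow> 'k \<Rightarrow> ('a \<rightharpoonup> 'a)" where
  "partial1 \<phi> r t = strong_lim (at 0) (\<lambda>h x. inverse h *\<^sub>K (\<phi> (r + h) t x - \<phi> r t x))"

definition partial2 :: "('k \<Rightarrow> 'k \<Rightarrow> 'a \<Rightarrow>\<^sub>L 'a) \<Rightarrow> 'k \<Rightarrow> 'k \<Rightarrow> ('a \<rightharpoonup> 'a)" where
  "partial2 \<phi> r t = strong_lim (at 0) (\<lambda>h x. inverse h *\<^sub>K (\<phi> r (t + h) x - \<phi> r t x))"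

definition cotranslation :: "('k \<Rightarrow> 'k \<Rightarrow> 'a \<Rightarrow>\<^sub>L 'a) \<Rightarrow> bool" where
  "cotranslation Z \<longleftrightarrow> (\<forall>r t. Z r t \<in> invertible_ops) \<and>
     (\<forall>r s t. Z r (t + s) = Z (r + s) t o\<^sub>L Z r s)"

text \<open>Derivability means that the strong derivative is a densely defined operator.\<close>

definition differentiable_cotranslation :: "('k \<Rightarrow> 'k \<Rightarrow> 'a \<Rightarrow>\<^sub>L 'a) \<Rightarrow> bool" where
  "differentiable_cotranslation Z \<longleftrightarrow> cotranslation Z \<and>
     continuous_map euclidean (subtopology strong_operator_topology invertible_ops)
       (\<lambda>(r, t). Z r t) \<and>
     (\<forall>r. partial2 Z r 0 \<in> densely_defined_ops)"

definition infinitesimal_generator :: "('k \<Rightarrow> 'k \<Rightarrow> 'a \<Rightarrow>\<^sub>L 'a) \<Rightarrow> 'k \<Rightarrow> ('a \<rightharpoonup> 'a)" where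
  "infinitesimal_generator Z = (\<lambda>t. partial2 Z t 0)"

text \<open>
  The compositions with \<open>A r\<close> and \<open>A t\<close> below have their natural domains
  \<open>{x. \<Psi> r t x \<in> dom (A r)}\<close> and \<open>dom (A t)\<close>.
\<close>

definition evolution_operator ::
    "('k \<Rightarrow> ('a \<rightharpoonup> 'a)) \<Rightarrow> ('k \<Rightarrow> 'k \<Rightarrow> 'a \<Rightarrow>\<^sub>L 'a) \<Rightarrow> bool" where
  "evolution_operator A \<Psi> \<longleftrightarrow>
     (\<forall>r t. \<Psi> r t \<in> bounded_ops) \<and>
     (\<forall>r. \<Psi> r r = id_blinfun) \<and>
     (\<forall>r s t. \<Psi> r t o\<^sub>L \<Psi> t s = \<Psi> r s) \<and>
     continuous_map euclidean (subtopology strong_operator_topology bounded_ops)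
       (\<lambda>(r, t). \<Psi> r t) \<and>
     (\<forall>r t. partial1 \<Psi> r t = A r \<circ>\<^sub>m (Some \<circ> blinfun_apply (\<Psi> r t))) \<and>
     (\<forall>r t. partial2 \<Psi> r t = (Some \<circ> (\<lambda>y. - \<Psi> r t y)) \<circ>\<^sub>m A t)"

end

end

theory Submission
  imports Defs
begin

text \<open>
  The correspondence is \<open>Z(r, t) = \<Psi>(r + t, r)\<close> and \<open>\<Psi>(r, t) = Z(t, r - t)\<close>.  The only analytic
  point is the derivative of \<open>\<Psi>\<close> in its second variable.  By the cocycle identity the difference
  quotients \<open>p\<^sub>h\<close> of \<open>\<Psi>(r, \<cdot>)x\<close> at \<open>t\<close> and \<open>q\<^sub>h\<close> of \<open>\<Psi>(\<cdot>, t)x\<close> at \<open>t\<close> satisfy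
  \<open>p\<^sub>h = -\<Psi>(r, t + h) q\<^sub>h\<close> and \<open>q\<^sub>h = -\<Psi>(t + h, r) p\<^sub>h\<close>.  By the uniform boundedness principle strongly
  convergent operators may be applied to convergent vectors, so either quotient converges if and
  only if the other one does; this also gives the equality of the domains.
\<close>

text \<open>Baire's theorem: the closed sets \<open>K n\<close> on which all \<open>f i\<close> are
  bounded by \<open>n\<close> exhaust the space, so one of them contains a ball. Linearity carries
  the bound on this ball over to the operator norms.\<close>

lemma uniform_boundedness:
  fixes f :: "'i \<Rightarrow> 'a::banach \<Rightarrow>\<^sub>L 'b::real_normed_vector"
  assumes "\<And>x. \<exists>B. \<forall>i\<in>I. norm (f i x) \<le> B"
  shows "\<exists>C\<ge>0. \<forall>i\<in>I. norm (f i) \<le> C"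
proof -
  define K where "K n = {x. \<forall>i\<in>I. norm (f i x) \<le> real n}" for n
  have "\<exists>n. x \<in> K n" for x
  proof -
    obtain B where B: "\<forall>i\<in>I. norm (f i x) \<le> B"
      using assms by blast
    have "x \<in> K (nat \<lceil>B\<rceil>)"
      using B order_trans[OF _ real_nat_ceiling_ge] by (simp add: K_def)
    then show ?thesis ..
  qed
  then have "(\<Union>n. K n) = UNIV"
    by blast
  moreover have closed: "closed (K n)" for n
  proof -
    have "K n = (\<Inter>i\<in>I. {x. norm (f i x) \<le> real n})"
      by (auto simp: K_def)
    then show ?thesis
      by (auto intro!: closed_INT closed_Collect_le continuous_intros)
  qed
  ultimately have "\<exists>n. interior (K n) \<noteq> {}"
    using Baire_category_alt[of "euclidean :: 'a topology" "range K"]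
    by (fastforce simp: completely_metrizable_space_euclidean)
  then obtain n a where "a \<in> interior (K n)"
    by blast
  then obtain e where e: "e > 0" "cball a e \<subseteq> K n"
    unfolding mem_interior_cball by blast
  have "norm (f i x) \<le> 2 * real n / e * norm x" if i: "i \<in> I" for i x
  proof (cases "x = 0")
    case False
    \<comment> \<open>The rescaling puts both \<open>a\<close> and \<open>a + u\<close> into the
      ball, so \<open>f i u\<close> is a difference of two vectors of norm at most \<open>n\<close>;
      this is where \<open>2 * n / e\<close> comes from.\<close>
    define u where "u = (e / norm x) *\<^sub>R x"
    have "norm u = e"
      using e(1) False by (simp add: u_def)
    then have "a \<in> K n" "a + u \<in> K n"
      using e(1) by (auto simp: dist_norm intro!: subsetD[OF e(2)])
    then have "norm (f i a) \<le> real n" "norm (f i (a + u)) \<le> real n"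
      using i by (simp_all add: K_def)
    then have "norm (f i (a + u) - f i a) \<le> 2 * real n"
      using norm_triangle_ineq4[of "f i (a + u)" "f i a"] by linarith
    then have "e / norm x * norm (f i x) \<le> 2 * real n"
      using e(1) by (simp add: u_def blinfun.bilinear_simps)
    then show ?thesis
      using e(1) False by (simp add: field_simps)
  qed simp
  then have "\<forall>i\<in>I. norm (f i) \<le> 2 * real n / e"
    using e(1) by (intro ballI norm_blinfun_bound) auto
  then show ?thesis
    using e(1) by (intro exI[of _ "2 * real n / e"]) auto
qed

text \<open>Split \<open>T n (v n)\<close> into \<open>T n (v n - y) + T n y\<close>. Pointwise
  convergence bounds the norms of the \<open>T n\<close> uniformly, so the first summand vanishes in
  the limit.\<close>

lemma strong_tendsto_apply_sequentially:
  fixes T :: "nat \<Rightarrow> 'a::banach \<Rightarrow>\<^sub>L 'b::real_normed_vector"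
  assumes T: "\<And>x. (\<lambda>n. T n x) \<longlonglongrightarrow> S x" and v: "v \<longlonglongrightarrow> y"
  shows "(\<lambda>n. T n (v n)) \<longlonglongrightarrow> S y"
proof -
  have "\<exists>B. \<forall>n\<in>UNIV. norm (T n x) \<le> B" for x
    using convergent_imp_Bseq[OF convergentI[OF T]] by (auto simp: Bseq_def)
  from uniform_boundedness[OF this] obtain C where C: "C \<ge> 0" "\<And>n. norm (T n) \<le> C"
    by auto
  have lim: "(\<lambda>n. C * norm (v n - y)) \<longlonglongrightarrow> 0"
    using v by (auto intro!: tendsto_mult_right_zero tendsto_norm_zero simp: LIM_zero_iff)
  have "norm (T n (v n - y)) \<le> C * norm (v n - y)" for n
    by (meson C(2) mult_right_mono norm_blinfun norm_ge_zero order_trans)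
  then have "(\<lambda>n. T n (v n - y)) \<longlonglongrightarrow> 0"
    by (intro Lim_null_comparison[OF _ lim] always_eventually allI)
  from tendsto_add[OF this T[of y]] show ?thesis
    by (simp add: blinfun.diff_right)
qed

text \<open>Convergence along \<open>at a\<close> bounds \<open>T h x\<close> only for
  \<open>h\<close> near \<open>a\<close>, with a neighbourhood depending on \<open>x\<close>,
  whereas a convergent sequence is bounded as a whole. Hence the passage to sequences.\<close>

lemma strong_tendsto_apply:
  fixes T :: "'c::first_countable_topology \<Rightarrow> 'a::banach \<Rightarrow>\<^sub>L 'b::real_normed_vector"
  assumes "\<And>x. ((\<lambda>h. T h x) \<longlongrightarrow> S x) (at a)" and "(v \<longlongrightarrow> y) (at a)"
  shows "((\<lambda>h. T h (v h)) \<longlongrightarrow> S y) (at a)"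
  using assms strong_tendsto_apply_sequentially[of "\<lambda>n. T (X n)" S "\<lambda>n. v (X n)" y for X]
  unfolding tendsto_at_iff_sequentially comp_def by blast

text \<open>Since \<open>y\<close> is arbitrary, the case \<open>m = None\<close> is covered too:
  there no limit exists. Domains and values are thus compared at once.\<close>

lemma strong_lim_eqI:
  assumes "F \<noteq> bot" "\<And>y. ((\<lambda>h. D h x) \<longlongrightarrow> y) F \<longleftrightarrow> m = Some y"
  shows "strong_lim F D x = m"
  using assms strong_lim_eq_Some_iff[OF assms(1), of D x] by (metis not_None_eq)

lemma strongly_continuous_iff:
  fixes \<phi> :: "'c::topological_space \<Rightarrow> 'd::topological_space \<Rightarrow> 'a::real_normed_vector \<Rightarrow>\<^sub>L 'b::real_normed_vector"
  shows "continuous_map euclidean (subtopology strong_operator_topology S) (\<lambda>(r, t). \<phi> r t) \<longleftrightarrow>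
    (\<forall>r t. \<phi> r t \<in> S) \<and> (\<forall>x. continuous_on UNIV (\<lambda>p. \<phi> (fst p) (snd p) x))"
  by (auto simp: continuous_map_in_subtopology continuous_on_strong_operator_topo_iff_coordinatewise
      case_prod_unfold Pi_iff)

lemma tendsto_compose_jointly_continuous:
  assumes "continuous_on UNIV (\<lambda>p. \<phi> (fst p) (snd p))"
    and "(f \<longlongrightarrow> a) F" "(g \<longlongrightarrow> b) F"
  shows "((\<lambda>h. \<phi> (f h) (g h)) \<longlongrightarrow> \<phi> a b) F"
  using continuous_on_tendsto_compose[OF assms(1) tendsto_Pair[OF assms(2,3)]] by simp

context banach_over
begin

lemma bounded_opsD: "T \<in> bounded_ops \<Longrightarrow> T (c *\<^sub>K x) = c *\<^sub>K T x"
  by (simp add: bounded_ops_def)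

lemma invertible_opsD: "T \<in> invertible_ops \<Longrightarrow> T \<in> bounded_ops"
  by (simp add: invertible_ops_def)

text \<open>Taking \<open>s = t = 0\<close> makes \<open>Z r 0\<close> idempotent, and an idempotent
  with a left inverse is the identity.\<close>

lemma cotranslation_zero:
  assumes "cotranslation Z"
  shows "Z r 0 = id_blinfun"
proof -
  obtain S where S: "S o\<^sub>L Z r 0 = id_blinfun"
    using assms unfolding cotranslation_def invertible_ops_def by blast
  have "Z r (0 + 0) = Z (r + 0) 0 o\<^sub>L Z r 0"
    using assms unfolding cotranslation_def by blast
  then have idem: "Z r 0 (Z r 0 x) = Z r 0 x" for x
    by (simp flip: blinfun_apply_blinfun_compose)
  have inv: "S (Z r 0 x) = x" for x
    by (simp add: S flip: blinfun_apply_blinfun_compose)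
  have "Z r 0 x = x" for x
    using idem[of x] inv by metis
  then show ?thesis
    by (intro blinfun_eqI) simp
qed

text \<open>The quotient at \<open>(r, t)\<close> applied to \<open>x\<close> is literally the
  quotient at \<open>(r, r)\<close> applied to \<open>\<Psi> r t x\<close>, so the domains agree as
  well.\<close>

lemma partial1_cocycle:
  assumes "\<And>r s t. \<Psi> r t o\<^sub>L \<Psi> t s = \<Psi> r s" "\<And>r. \<Psi> r r = id_blinfun"
  shows "partial1 \<Psi> r t = partial1 \<Psi> r r \<circ>\<^sub>m (Some \<circ> blinfun_apply (\<Psi> r t))"
proof -
  have "\<Psi> (r + h) t x = \<Psi> (r + h) r (\<Psi> r t x)" "\<Psi> r r (\<Psi> r t x) = \<Psi> r t x" for h x
    by (simp_all add: assms flip: blinfun_apply_blinfun_compose)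
  then show ?thesis
    by (simp add: partial1_def strong_lim_def fun_eq_iff)
qed

lemma partial2_cocycle:
  assumes bounded: "\<And>r t. \<Psi> r t \<in> bounded_ops"
    and comp: "\<And>r s t. \<Psi> r t o\<^sub>L \<Psi> t s = \<Psi> r s" and id: "\<And>r. \<Psi> r r = id_blinfun"
    and cont: "\<And>x. continuous_on UNIV (\<lambda>p. \<Psi> (fst p) (snd p) x)"
  shows "partial2 \<Psi> r t = (Some \<circ> (\<lambda>y. - \<Psi> r t y)) \<circ>\<^sub>m partial1 \<Psi> t t"
proof
  fix x
  have comp': "\<Psi> u v (\<Psi> v w z) = \<Psi> u w z" for u v w z
    by (simp add: comp flip: blinfun_apply_blinfun_compose)
  have lim: "((\<lambda>h. \<Psi> (f h) (g h) z) \<longlongrightarrow> \<Psi> a b z) (at 0)"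
    if "(f \<longlongrightarrow> a) (at 0)" "(g \<longlongrightarrow> b) (at 0)" for f g :: "'k \<Rightarrow> 'k" and a b z
    using tendsto_compose_jointly_continuous[where \<phi> = "\<lambda>u v. \<Psi> u v z"] cont that by blast
  have shift: "((\<lambda>h. t + h) \<longlongrightarrow> t) (at (0::'k))"
    by (auto intro!: tendsto_eq_intros)
  define p where "p h = inverse h *\<^sub>K (\<Psi> r (t + h) x - \<Psi> r t x)" for h
  define q where "q h = inverse h *\<^sub>K (\<Psi> (t + h) t x - \<Psi> t t x)" for h
  \<comment> \<open>\<open>\<Psi> r (t + h)\<close> maps \<open>\<Psi> (t + h) t x - x\<close> to
    \<open>\<Psi> r t x - \<Psi> r (t + h) x\<close>; the reversed order gives the sign, and
    linearity over the field lets \<open>inverse h\<close> pass through.\<close>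
  have p_eq: "p h = - \<Psi> r (t + h) (q h)" and q_eq: "q h = - \<Psi> (t + h) r (p h)" for h
    by (simp_all add: p_def q_def bounded_opsD[OF bounded] blinfun.diff_right comp' id
        flip: scale_minus_right)
  have pI: "(p \<longlongrightarrow> - \<Psi> r t y) (at 0)" if "(q \<longlongrightarrow> y) (at 0)" for y
    using tendsto_minus[OF strong_tendsto_apply[OF lim[OF tendsto_const[of r] shift] that]]
    by (simp flip: p_eq)
  have qI: "(q \<longlongrightarrow> - \<Psi> t r y) (at 0)" if "(p \<longlongrightarrow> y) (at 0)" for y
    using tendsto_minus[OF strong_tendsto_apply[OF lim[OF shift tendsto_const[of r]] that]]
    by (simp flip: q_eq)
  have q_iff: "partial1 \<Psi> t t x = Some y \<longleftrightarrow> (q \<longlongrightarrow> y) (at 0)" for y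
    unfolding partial1_def q_def[abs_def] by (rule strong_lim_eq_Some_iff) simp
  have "(p \<longlongrightarrow> z) (at 0) \<longleftrightarrow> (\<exists>y. partial1 \<Psi> t t x = Some y \<and> - \<Psi> r t y = z)" for z
  proof
    assume "(p \<longlongrightarrow> z) (at 0)"
    then show "\<exists>y. partial1 \<Psi> t t x = Some y \<and> - \<Psi> r t y = z"
      \<comment> \<open>The witness is the limit of \<open>q\<close> supplied by \<open>qI\<close>;
        \<open>\<Psi> r t\<close> undoes \<open>\<Psi> t r\<close> and the two signs cancel.\<close>
      by (auto simp: q_iff blinfun.minus_right comp' id intro!: exI[of _ "- \<Psi> t r z"] qI)
  qed (auto simp: q_iff intro: pI)
  then show "partial2 \<Psi> r t x = ((Some \<circ> (\<lambda>y. - \<Psi> r t y)) \<circ>\<^sub>m partial1 \<Psi> t t) x"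
    unfolding partial2_def p_def
    by (intro strong_lim_eqI) (auto simp: map_comp_Some_iff)
qed

lemma evolution_operator_imp_cotranslation:
  assumes \<Psi>: "evolution_operator A \<Psi>" and A: "\<And>t. A t \<in> densely_defined_ops"
  defines "Z \<equiv> \<lambda>r t. \<Psi> (r + t) r"
  shows "differentiable_cotranslation Z \<and> A = infinitesimal_generator Z"
proof -
  have bounded: "\<Psi> r t \<in> bounded_ops" and id: "\<Psi> r r = id_blinfun"
    and comp: "\<Psi> r t o\<^sub>L \<Psi> t s = \<Psi> r s"
    and partial1: "partial1 \<Psi> r t = A r \<circ>\<^sub>m (Some \<circ> blinfun_apply (\<Psi> r t))" for r s t
    using \<Psi> unfolding evolution_operator_def by blast+
  have cont: "continuous_on UNIV (\<lambda>p. \<Psi> (fst p) (snd p) x)" for x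
    using \<Psi> by (simp add: evolution_operator_def strongly_continuous_iff)
  have inv: "Z r t \<in> invertible_ops" for r t
    unfolding Z_def invertible_ops_def by (auto simp: bounded comp id intro!: bexI[of _ "\<Psi> r (r + t)"])
  have "Z r (t + s) = Z (r + s) t o\<^sub>L Z r s" for r s t
    unfolding Z_def comp by (simp add: algebra_simps)
  with inv have "cotranslation Z"
    by (simp add: cotranslation_def)
  moreover have "continuous_on UNIV (\<lambda>p. Z (fst p) (snd p) x)" for x
    using continuous_on_compose2[OF cont, of UNIV "\<lambda>p. (fst p + snd p, fst p)" x]
    by (simp add: Z_def continuous_on_Pair continuous_on_fst continuous_on_snd continuous_on_add)
  moreover have "(\<lambda>r. partial2 Z r 0) = A"
  proof
    fix r
    show "partial2 Z r 0 = A r"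
      \<comment> \<open>At \<open>0\<close> the quotient of \<open>Z r\<close> is that of
        \<open>\<Psi>\<close> in its first variable on the diagonal, where \<open>\<Psi> r r\<close>
        is the identity and leaves \<open>A r\<close> alone.\<close>
      using partial1[of r r] by (simp add: partial1_def partial2_def Z_def id map_comp_def fun_eq_iff)
  qed
  ultimately show ?thesis
    using A inv
    by (auto simp: differentiable_cotranslation_def strongly_continuous_iff infinitesimal_generator_def)
qed

lemma cotranslation_imp_evolution_operator:
  assumes Z: "differentiable_cotranslation Z"
  shows "evolution_operator (infinitesimal_generator Z) (\<lambda>r t. Z t (r - t))"
proof -
  define \<Psi> where "\<Psi> = (\<lambda>r t. Z t (r - t))"
  have cot: "cotranslation Z" and cont_Z: "continuous_on UNIV (\<lambda>p. Z (fst p) (snd p) x)" for x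
    using Z by (auto simp: differentiable_cotranslation_def strongly_continuous_iff)
  have bounded: "\<Psi> r t \<in> bounded_ops" for r t
    using cot unfolding \<Psi>_def by (simp add: cotranslation_def invertible_opsD)
  have id: "\<Psi> r r = id_blinfun" for r
    unfolding \<Psi>_def using cotranslation_zero[OF cot] by simp
  have comp: "\<Psi> r t o\<^sub>L \<Psi> t s = \<Psi> r s" for r s t
  proof -
    \<comment> \<open>The cotranslation law from base point \<open>s\<close> with increments
      \<open>t - s\<close> and \<open>r - t\<close>; the intermediate point is
      \<open>t\<close>.\<close>
    have "Z s ((r - t) + (t - s)) = Z (s + (t - s)) (r - t) o\<^sub>L Z s (t - s)"
      using cot unfolding cotranslation_def by blast
    then show ?thesis
      by (simp add: \<Psi>_def)
  qed
  have cont: "continuous_on UNIV (\<lambda>p. \<Psi> (fst p) (snd p) x)" for x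
    using continuous_on_compose2[OF cont_Z, of UNIV "\<lambda>p. (snd p, fst p - snd p)" x]
    by (simp add: \<Psi>_def continuous_on_Pair continuous_on_fst continuous_on_snd continuous_on_diff)
  \<comment> \<open>On the diagonal \<open>\<Psi> (r + h) r\<close> is \<open>Z r h\<close>. Both
    cocycle lemmas express their derivative through the diagonal one, hence through the
    generator.\<close>
  have generator: "infinitesimal_generator Z r = partial1 \<Psi> r r" for r
    by (simp add: infinitesimal_generator_def partial1_def partial2_def \<Psi>_def)
  have "evolution_operator (infinitesimal_generator Z) \<Psi>"
    unfolding evolution_operator_def strongly_continuous_iff generator
    using bounded id comp cont partial1_cocycle[of \<Psi>, OF comp id] partial2_cocycle[of \<Psi>, OF bounded comp id cont]
    by blast
  then show ?thesis
    by (simp add: \<Psi>_def)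
qed

end

theorem theorem4p10:
  fixes scale :: "'k::real_or_complex \<Rightarrow> 'a::banach \<Rightarrow> 'a"
    and A :: "'k \<Rightarrow> ('a \<rightharpoonup> 'a)"
  assumes "banach_over scale"
    and "\<And>t. A t \<in> banach_over.densely_defined_ops scale"
  shows "(\<exists>\<Psi>. banach_over.evolution_operator scale A \<Psi>) \<longleftrightarrow>
    (\<exists>Z. banach_over.differentiable_cotranslation scale Z \<and>
         A = banach_over.infinitesimal_generator scale Z)"
  using banach_over.evolution_operator_imp_cotranslation[OF assms(1), of A]
    assms(2) banach_over.cotranslation_imp_evolution_operator[OF assms(1)]
  by blast

end
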